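(* Let $T\in(0,+\infty]$ and let $(X(t))_{0\le t<T}$, $X(t)=(x_1(t),\dots,x_N(t))\in\mathbb{R}^{nN}$, be a family of point clouds evolving according to $$\frac{\mathrm{d}}{\mathrm{d}t}x_i(t)=\frac1\varepsilon\sum_{j=1}^N\omega_{ij}(t)\,\Pi_{ij}(t)\bigl(x_j(t)-x_i(t)\bigr),\qquad i=1,\dots,N,$$ where $\omega_{ii}(t)=0$ and, for $i\ne j$, $$\omega_{ij}(t)=-\frac dn\,\frac{m_j(t)\,\rho'\!\left(\frac{|x_j(t)-x_i(t)|}{\varepsilon}\right)\frac1{|x_j(t)-x_i(t)|}}{\sum_{l=1}^Nm_l(t)\,\xi\!\left(\frac{|x_l(t)-x_i(t)|}{\varepsilon}\right)}.$$ Suppose that, for some $\nu\in\mathbb{R}^n$ and $\mu\in\mathbb{R}$, (i) the initial point cloud fulfills $x_i(0)\cdot\nu\le\mu$ for $i=1,\dots,N$; (ii) for all $0\le t<T$, if $x_i(t)$ is a point on the boundary of the convex hull of $X(t)$, then for all points $x_j(t)$ such that $|x_j(t)-x_i(t)|<\varepsilon$, the vector $\Pi_{ij}(t)(x_j(t)-x_i(t))$ at $x_i(t)$ points inside the convex hull of $X(t)$. Then, independently of the choices of the masses $m_i(t)>0$, for all $0\le t<T$, $$x_i(t)\cdot\nu\le\mu\qquad\text{for all }i=1,\dots,N.$$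
   Context: $1\le d\le n$ are integers, $\varepsilon>0$. $\rho,\xi\in C^\infty(\mathbb{R})$ are fixed nonnegative even functions, compactly supported in $[-1,1]$, positive on $(0,1)$, $\rho$ nonincreasing on $[0,1]$, with $n\,\xi(s)=-s\,\rho'(s)$ for $s\in(-1,1)$. Masses $m_i(t)=m_i(X(t))>0$ and directions $P_i(t)=P_i(X(t))$ ($d$-dimensional linear subspaces of $\mathbb{R}^n$) are computed from the positions by a prescribed rule; $\Pi_P$ is the orthogonal projector onto a subspace $P$, and $\Pi_{ij}(t)$ is one fixed choice among $$\Pi_{P_j},\quad-2\Pi_{P_j^\perp},\quad2\,\mathrm{Id},\quad\Pi_{P_i^\perp}\circ\Pi_{P_j},\quad-2\Pi_{P_i^\perp}\circ\Pi_{P_j^\perp},\quad2\Pi_{P_i^\perp}$$ with $P_i=P_i(t)$, $P_j=P_j(t)$. The right-hand side of the evolution is understood to be well defined: the denominators are positive and a term with $x_j(t)=x_i(t)$ is taken to be zero. A vector $v$ at a point $x$ of the convex hull $\mathcal C$ of a finite set "points inside $\mathcal C$" if $x+sv\in\mathcal C$ for some $s>0$ (in particular $v=0$ is allowed). The boundary of the convex hull is its topological boundary in $\mathbb{R}^n$. *)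

theory Defs
  imports "HOL-Analysis.Analysis"
begin

definition smooth_real :: "(real \<Rightarrow> real) \<Rightarrow> bool" where
  "smooth_real f \<longleftrightarrow> (\<forall>k x. (deriv ^^ k) f field_differentiable (at x))"

definition kernel_pair :: "nat \<Rightarrow> (real \<Rightarrow> real) \<Rightarrow> (real \<Rightarrow> real) \<Rightarrow> bool" where
  "kernel_pair n \<rho> \<xi> \<longleftrightarrow>
     (\<forall>f\<in>{\<rho>, \<xi>}. smooth_real f \<and> (\<forall>s. 0 \<le> f s) \<and> (\<forall>s. f (- s) = f s) \<and>
        closure {s. f s \<noteq> 0} \<subseteq> {-1..1} \<and> (\<forall>s\<in>{0<..<1}. 0 < f s)) \<and>
     antimono_on {0..1} \<rho> \<and>
     (\<forall>s\<in>{-1<..<1}. real n * \<xi> s = - s * deriv \<rho> s)"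

definition orth_proj :: "'a::euclidean_space set \<Rightarrow> 'a \<Rightarrow> 'a" where
  "orth_proj P v = (THE w. w \<in> P \<and> v - w \<in> P\<^sup>\<bottom>)"

lemma orth_proj_unique:
  fixes P :: "'a::euclidean_space set"
  assumes "subspace P"
  shows "\<exists>!w. w \<in> P \<and> v - w \<in> P\<^sup>\<bottom>"
proof -
  obtain y z where y: "y \<in> span P" and z: "\<And>w. w \<in> span P \<Longrightarrow> orthogonal z w" and v: "v = y + z"
    using orthogonal_subspace_decomp_exists[of P v] by blast
  have sp: "span P = P" using assms by (simp add: span_eq_iff)
  show ?thesis
  proof (rule ex1I[of _ y])
    show "y \<in> P \<and> v - y \<in> P\<^sup>\<bottom>"
      using y z v sp by (auto simp: orthogonal_comp_def orthogonal_commute)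
  next
    fix w assume w: "w \<in> P \<and> v - w \<in> P\<^sup>\<bottom>"
    have wy: "w - y \<in> P" using w y sp assms by (simp add: subspace_diff)
    have "(w - y) \<bullet> (v - w) = 0" "z \<bullet> (w - y) = 0"
      using w wy z sp by (auto simp: orthogonal_comp_def orthogonal_def)
    then have "(w - y) \<bullet> (w - y) = 0"
      using v by (simp add: inner_diff_left inner_diff_right inner_add_left inner_add_right inner_commute)
    then show "w = y" by simp
  qed
qed

datatype proj_choice =
  Proj_j | Neg_two_perp_j | Two_id | Perp_i_proj_j | Neg_two_perp_i_perp_j | Two_perp_i

fun proj_op :: "proj_choice \<Rightarrow> 'a::euclidean_space set \<Rightarrow> 'a set \<Rightarrow> 'a \<Rightarrow> 'a" where
  "proj_op Proj_j Q\<^sub>i Q\<^sub>j v = orth_proj Q\<^sub>j v"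
| "proj_op Neg_two_perp_j Q\<^sub>i Q\<^sub>j v = - 2 *\<^sub>R orth_proj (Q\<^sub>j\<^sup>\<bottom>) v"
| "proj_op Two_id Q\<^sub>i Q\<^sub>j v = 2 *\<^sub>R v"
| "proj_op Perp_i_proj_j Q\<^sub>i Q\<^sub>j v = orth_proj (Q\<^sub>i\<^sup>\<bottom>) (orth_proj Q\<^sub>j v)"
| "proj_op Neg_two_perp_i_perp_j Q\<^sub>i Q\<^sub>j v = - 2 *\<^sub>R orth_proj (Q\<^sub>i\<^sup>\<bottom>) (orth_proj (Q\<^sub>j\<^sup>\<bottom>) v)"
| "proj_op Two_perp_i Q\<^sub>i Q\<^sub>j v = 2 *\<^sub>R orth_proj (Q\<^sub>i\<^sup>\<bottom>) v"

text \<open>A point cloud of \<open>N\<close> points is a vector \<open>X :: (real^'n)^'N\<close>, where \<open>N = CARD('N)\<close>;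
  \<open>m j\<close> is the mass at \<open>X $ j\<close>.\<close>

definition denom :: "real \<Rightarrow> (real \<Rightarrow> real) \<Rightarrow> ('N \<Rightarrow> real) \<Rightarrow> (real^'n)^'N::finite \<Rightarrow> 'N \<Rightarrow> real" where
  "denom \<epsilon> \<xi> m X i = (\<Sum>l\<in>UNIV. m l * \<xi> (norm (X $ l - X $ i) / \<epsilon>))"

definition weight ::
  "nat \<Rightarrow> real \<Rightarrow> (real \<Rightarrow> real) \<Rightarrow> (real \<Rightarrow> real) \<Rightarrow> ('N \<Rightarrow> real) \<Rightarrow> (real^'n)^'N::finite \<Rightarrow> 'N \<Rightarrow> 'N \<Rightarrow> real"
where
  "weight d \<epsilon> \<rho> \<xi> m X i j =
     (if i = j then 0
      else - (real d / real CARD('n)) *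
        ((m j * deriv \<rho> (norm (X $ j - X $ i) / \<epsilon>) * (1 / norm (X $ j - X $ i))) / denom \<epsilon> \<xi> m X i))"

text \<open>Terms with \<open>X $ j = X $ i\<close> are zero by convention; there the value of \<^term>\<open>weight\<close> is irrelevant.\<close>

definition velocity ::
  "nat \<Rightarrow> real \<Rightarrow> (real \<Rightarrow> real) \<Rightarrow> (real \<Rightarrow> real) \<Rightarrow> proj_choice \<Rightarrow> ('N \<Rightarrow> real) \<Rightarrow> ('N \<Rightarrow> (real^'n) set)
    \<Rightarrow> (real^'n)^'N::finite \<Rightarrow> 'N \<Rightarrow> real^'n"
where
  "velocity d \<epsilon> \<rho> \<xi> c m P X i =
     (1 / \<epsilon>) *\<^sub>R (\<Sum>j\<in>UNIV. if X $ j = X $ i then 0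
        else weight d \<epsilon> \<rho> \<xi> m X i j *\<^sub>R proj_op c (P i) (P j) (X $ j - X $ i))"

definition cloud_hull :: "(real^'n)^'N::finite \<Rightarrow> (real^'n) set" where
  "cloud_hull X = convex hull (range (\<lambda>i. X $ i))"

definition points_inside :: "'a::real_vector set \<Rightarrow> 'a \<Rightarrow> 'a \<Rightarrow> bool" where
  "points_inside C x v \<longleftrightarrow> (\<exists>s>0. x + s *\<^sub>R v \<in> C)"

end

(*
  Track the functions t |-> X_i(t) . \<nu>. At an index where this is maximal among all i, the point
  X_i(t) lies on the boundary of the hull and the hull lies in the half-space below it, so
  every direction pointing inside has nonpositive inner product with \<nu>; as the weights are
  nonnegative and vanish at distance \<ge> \<epsilon>, the maximal function has nonpositive derivative. A maximum
  principle then bounds all of them by \<mu>.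
*)
theory Submission
  imports Defs
begin

text \<open>The upper envelope of the family need not be differentiable, so the argument stays with
  the single functions and looks at a joint maximum over index and time. A small tilt makes the
  slope there strictly negative, which contradicts maximality from the left.\<close>

lemma finite_family_le_initial_bound:
  fixes f f' :: "'i::finite \<Rightarrow> real \<Rightarrow> real"
  assumes "a \<le> b"
    and deriv: "\<And>i t. t \<in> {a..b} \<Longrightarrow> (f i has_real_derivative f' i t) (at t within {a..b})"
    and active: "\<And>i t. t \<in> {a..b} \<Longrightarrow> (\<And>j. f j t \<le> f i t) \<Longrightarrow> f' i t \<le> 0"
    and initial: "\<And>i. f i a \<le> \<mu>"
  shows "f i b \<le> \<mu>"
proof -
  have bound: "f i b \<le> \<mu> + \<delta> * (b - a)" if "\<delta> > 0" for \<delta>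
  proof (rule ccontr)
    assume exceeds: "\<not> f i b \<le> \<mu> + \<delta> * (b - a)"
    \<comment> \<open>The tilt turns slope at most 0 into slope at most \<open>- \<delta>\<close>.
      It is the same for every index, so the ordering of the family at each time is
      unchanged.\<close>
    define g where "g = (\<lambda>i t. f i t - \<delta> * (t - a))"
    have g_deriv: "(g i has_real_derivative f' i t - \<delta>) (at t within {a..b})"
      if "t \<in> {a..b}" for i t
      unfolding g_def using deriv[OF that, of i] by (auto intro!: derivative_eq_intros)
    have "continuous_on {a..b} (g i)" for i
      using g_deriv by (intro DERIV_continuous_on)
    then have "\<exists>t\<in>{a..b}. \<forall>s\<in>{a..b}. g i s \<le> g i t" for i
      using \<open>a \<le> b\<close> by (intro continuous_attains_sup) auto
    then obtain \<tau> where \<tau>: "\<And>i. \<tau> i \<in> {a..b}" "\<And>i s. s \<in> {a..b} \<Longrightarrow> g i s \<le> g i (\<tau> i)"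
      by metis
    \<comment> \<open>Each index has its own best time; the best index among these gives a maximum
      over all indices and times at once.\<close>
    obtain k where k: "\<And>j. g j (\<tau> j) \<le> g k (\<tau> k)"
    proof -
      have "Max (range (\<lambda>i. g i (\<tau> i))) \<in> range (\<lambda>i. g i (\<tau> i))"
        by (intro Max_in) auto
      then obtain k where "Max (range (\<lambda>i. g i (\<tau> i))) = g k (\<tau> k)" by blast
      then have "g j (\<tau> j) \<le> g k (\<tau> k)" for j
        by (metis Max_ge finite finite_imageI rangeI)
      then show thesis by (rule that)
    qed
    have kmax: "g j s \<le> g k (\<tau> k)" if "s \<in> {a..b}" for j s
      using \<tau>(2)[OF that] k order_trans by blast
    \<comment> \<open>The tilt vanishes at \<open>a\<close> and equals exactly the slack
      \<open>\<delta> * (b - a)\<close> at \<open>b\<close>. Hence the joint maximum exceeds every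
      initial value, and there is room to the left of \<open>\<tau> k\<close>.\<close>
    have "g k (\<tau> k) > \<mu>"
      using kmax[of b i] \<open>a \<le> b\<close> exceeds by (simp add: g_def)
    moreover have "g k a \<le> \<mu>"
      using initial by (simp add: g_def)
    ultimately have "\<tau> k \<noteq> a" by auto
    then have "a < \<tau> k" using \<tau>(1)[of k] by auto
    have "f' k (\<tau> k) \<le> 0"
      using kmax[OF \<tau>(1)[of k]] by (intro active \<tau>(1)) (simp add: g_def)
    then have "f' k (\<tau> k) - \<delta> < 0" using \<open>\<delta> > 0\<close> by simp
    then obtain e where e: "e > 0"
      "\<And>h. 0 < h \<Longrightarrow> \<tau> k - h \<in> {a..b} \<Longrightarrow> h < e \<Longrightarrow> g k (\<tau> k) < g k (\<tau> k - h)"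
      using has_real_derivative_neg_dec_left[OF g_deriv[OF \<tau>(1)]] by blast
    \<comment> \<open>Halving \<open>e\<close> gives \<open>h < e\<close>; the cap
      \<open>\<tau> k - a\<close> keeps \<open>\<tau> k - h\<close> from dropping below
      \<open>a\<close>.\<close>
    define h where "h = min (e / 2) (\<tau> k - a)"
    have h: "0 < h" "h < e" "\<tau> k - h \<in> {a..b}"
      using \<open>e > 0\<close> \<open>a < \<tau> k\<close> \<tau>(1)[of k] by (auto simp: h_def min_def)
    then show False
      using e(2)[of h] kmax[of "\<tau> k - h" k] by simp
  qed
  show ?thesis
  \<comment> \<open>The degenerate interval is split off because letting the slack tend to 0 uses
    the tilt \<open>e / (b - a)\<close>.\<close>
  proof (cases "a = b")
    case True
    then show ?thesis using initial by simp
  next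
    case False
    then have "b - a > 0" using \<open>a \<le> b\<close> by simp
    show ?thesis
    proof (rule field_le_epsilon)
      fix e :: real assume "e > 0"
      then show "f i b \<le> \<mu> + e"
        using bound[of "e / (b - a)"] \<open>b - a > 0\<close> by simp
    qed
  qed
qed

text \<open>The sign comes from the identity linking the two kernels:
  \<open>- r * deriv \<rho> r\<close> is a nonnegative multiple of \<open>\<xi> r\<close>.\<close>

lemma kernel_pair_deriv_nonpos:
  assumes "kernel_pair n \<rho> \<xi>" "0 < r" "r < 1"
  shows "deriv \<rho> r \<le> 0"
proof -
  have "0 \<le> \<xi> r" "real n * \<xi> r = - r * deriv \<rho> r"
    using assms by (auto simp: kernel_pair_def)
  then have "0 \<le> - r * deriv \<rho> r"
    by (metis mult_nonneg_nonneg of_nat_0_le_iff)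
  then show ?thesis
    using \<open>0 < r\<close> by (simp add: mult_le_0_iff)
qed

text \<open>Every zero of a nonnegative differentiable function is a minimum, hence a critical
  point. The case \<open>r = 1\<close> matters: it is distance exactly \<open>\<epsilon>\<close>,
  about which the hypothesis on directions is silent.\<close>

lemma kernel_pair_deriv_eq_0:
  assumes "kernel_pair n \<rho> \<xi>" "1 \<le> r"
  shows "deriv \<rho> r = 0"
proof -
  have nonneg: "\<And>s. 0 \<le> \<rho> s" and supp: "closure {s. \<rho> s \<noteq> 0} \<subseteq> {-1..1}"
    and "smooth_real \<rho>"
    using assms by (auto simp: kernel_pair_def)
  then have diff: "\<rho> field_differentiable (at x)" for x
    unfolding smooth_real_def by (metis funpow_0)
  then have "continuous_on UNIV \<rho>"
    by (simp add: continuous_at_imp_continuous_on field_differentiable_imp_continuous_at)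
  then have "closed {s. \<rho> s = 0}"
    by (intro closed_Collect_eq) auto
  moreover have "{1<..} \<subseteq> {s. \<rho> s = 0}"
    using supp closure_subset[of "{s. \<rho> s \<noteq> 0}"] by force
  \<comment> \<open>Continuity carries the vanishing of \<open>\<rho>\<close> from beyond 1 to the
    endpoint 1 itself.\<close>
  ultimately have "closure {1<..} \<subseteq> {s. \<rho> s = 0}"
    by (rule closure_minimal[rotated])
  then have "\<rho> r = 0"
    using \<open>1 \<le> r\<close> by auto
  \<comment> \<open>The minimum is global, so the radius 1 of the neighbourhood is
    arbitrary.\<close>
  then show ?thesis
    using diff[of r] nonneg
    by (intro DERIV_local_min[of \<rho> _ r 1]) (auto simp: field_differentiable_derivI)
qed

lemma weight_nonneg:
  fixes X :: "(real^'n)^'N::finite"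
  assumes "kernel_pair n \<rho> \<xi>" "0 < \<epsilon>" "0 < m j" "0 < denom \<epsilon> \<xi> m X i"
    and "norm (X $ j - X $ i) < \<epsilon>" "X $ j \<noteq> X $ i"
  shows "0 \<le> weight d \<epsilon> \<rho> \<xi> m X i j"
proof -
  let ?r = "norm (X $ j - X $ i)"
  have "deriv \<rho> (?r / \<epsilon>) \<le> 0"
    using assms by (intro kernel_pair_deriv_nonpos) auto
  then have "m j * deriv \<rho> (?r / \<epsilon>) * (1 / ?r) / denom \<epsilon> \<xi> m X i \<le> 0"
    using assms by (auto simp: divide_le_0_iff mult_le_0_iff)
  from mult_nonpos_nonpos[OF _ this, of "- (real d / real CARD('n))"] show ?thesis
    by (simp add: weight_def)
qed

lemma weight_eq_0:
  fixes X :: "(real^'n)^'N::finite"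
  assumes "kernel_pair n \<rho> \<xi>" "0 < \<epsilon>" "\<epsilon> \<le> norm (X $ j - X $ i)"
  shows "weight d \<epsilon> \<rho> \<xi> m X i j = 0"
  using kernel_pair_deriv_eq_0[OF assms(1), of "norm (X $ j - X $ i) / \<epsilon>"] assms(2,3)
  by (simp add: weight_def)

lemma cloud_hull_inner_le:
  assumes "\<And>j. X $ j \<bullet> \<nu> \<le> M" "y \<in> cloud_hull X"
  shows "y \<bullet> \<nu> \<le> M"
proof -
  have "cloud_hull X \<subseteq> {y. \<nu> \<bullet> y \<le> M}"
    unfolding cloud_hull_def
    using assms(1) by (intro hull_minimal convex_halfspace_le) (auto simp: inner_commute)
  then show ?thesis
    using assms by (auto simp: inner_commute)
qed

text \<open>An interior point of the hull would be interior to the supporting half-space, yet this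
  point lies on its bounding hyperplane. A hull with empty interior is covered as well.\<close>

lemma extreme_point_in_frontier_cloud_hull:
  fixes X :: "(real^'n)^'N::finite"
  assumes "\<nu> \<noteq> 0" "\<And>j. X $ j \<bullet> \<nu> \<le> X $ i \<bullet> \<nu>"
  shows "X $ i \<in> frontier (cloud_hull X)"
proof -
  have "X $ i \<in> cloud_hull X"
    by (simp add: cloud_hull_def hull_inc)
  moreover have "X $ i \<notin> interior (cloud_hull X)"
  proof
    assume "X $ i \<in> interior (cloud_hull X)"
    moreover have "cloud_hull X \<subseteq> {y. \<nu> \<bullet> y \<le> \<nu> \<bullet> X $ i}"
      using cloud_hull_inner_le[OF assms(2)] by (auto simp: inner_commute)
    ultimately have "X $ i \<in> interior {y. \<nu> \<bullet> y \<le> \<nu> \<bullet> X $ i}"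
      using interior_mono by blast
    then show False
      using \<open>\<nu> \<noteq> 0\<close> by (simp add: interior_halfspace_le)
  qed
  ultimately show ?thesis
    using closure_subset by (auto simp: frontier_def)
qed

lemma points_inside_cloud_hull_inner_nonpos:
  assumes "\<And>j. X $ j \<bullet> \<nu> \<le> X $ i \<bullet> \<nu>" "points_inside (cloud_hull X) (X $ i) v"
  shows "v \<bullet> \<nu> \<le> 0"
proof -
  obtain s where "s > 0" "X $ i + s *\<^sub>R v \<in> cloud_hull X"
    using assms(2) by (auto simp: points_inside_def)
  then show ?thesis
    using cloud_hull_inner_le[OF assms(1)] by (fastforce simp: inner_add_left mult_le_0_iff)
qed

text \<open>The sum is nonpositive term by term: closer than \<open>\<epsilon>\<close>, a
  nonnegative weight multiplies an inward vector; farther away the weight is 0. The masses enter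
  only through their sign and that of the denominator, whence the independence of their
  choice.\<close>

lemma velocity_inner_nonpos:
  fixes X :: "(real^'n)^'N::finite"
  assumes kernels: "kernel_pair n \<rho> \<xi>" and "0 < \<epsilon>"
    and masses: "\<And>j. 0 < m j" and denominator: "0 < denom \<epsilon> \<xi> m X i"
    and inside: "\<And>j. norm (X $ j - X $ i) < \<epsilon> \<Longrightarrow>
      points_inside (cloud_hull X) (X $ i) (proj_op c (P i) (P j) (X $ j - X $ i))"
    and active: "\<And>j. X $ j \<bullet> \<nu> \<le> X $ i \<bullet> \<nu>"
  shows "velocity d \<epsilon> \<rho> \<xi> c m P X i \<bullet> \<nu> \<le> 0"
proof -
  have term_nonpos: "(if X $ j = X $ i then 0
      else weight d \<epsilon> \<rho> \<xi> m X i j *\<^sub>R proj_op c (P i) (P j) (X $ j - X $ i)) \<bullet> \<nu> \<le> 0" for j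
  proof (cases "norm (X $ j - X $ i) < \<epsilon>")
    case True
    have "proj_op c (P i) (P j) (X $ j - X $ i) \<bullet> \<nu> \<le> 0"
      using points_inside_cloud_hull_inner_nonpos[OF active inside[OF True]] .
    then show ?thesis
      using weight_nonneg[OF kernels \<open>0 < \<epsilon>\<close> masses denominator True]
      by (simp add: mult_nonneg_nonpos)
  next
    case False
    then show ?thesis
      using weight_eq_0[OF kernels \<open>0 < \<epsilon>\<close>, of X j i] by simp
  qed
  show ?thesis
    unfolding velocity_def inner_scaleR_left inner_sum_left
    using \<open>0 < \<epsilon>\<close> by (intro mult_nonneg_nonpos sum_nonpos term_nonpos) auto
qed

theorem proposition5p1:
  fixes d :: nat and \<epsilon> :: real and \<rho> \<xi> :: "real \<Rightarrow> real"
    and c :: proj_choice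
    and m :: "(real^'n)^'N \<Rightarrow> 'N \<Rightarrow> real"
    and P :: "(real^'n)^'N \<Rightarrow> 'N \<Rightarrow> (real^'n) set"
    and T :: ereal and X :: "real \<Rightarrow> (real^'n)^'N"
    and \<nu> :: "real^'n" and \<mu> :: real
  assumes d: "1 \<le> d" "d \<le> CARD('n)"
    and eps: "0 < \<epsilon>"
    and kernels: "kernel_pair CARD('n) \<rho> \<xi>"
    and T: "0 < T"
    and masses: "\<And>t i. 0 \<le> t \<Longrightarrow> ereal t < T \<Longrightarrow> 0 < m (X t) i"
    and directions: "\<And>t i. 0 \<le> t \<Longrightarrow> ereal t < T \<Longrightarrow> subspace (P (X t) i) \<and> dim (P (X t) i) = d"
    and denominators: "\<And>t i. 0 \<le> t \<Longrightarrow> ereal t < T \<Longrightarrow> 0 < denom \<epsilon> \<xi> (m (X t)) (X t) i"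
    and evolution: "\<And>t i. 0 \<le> t \<Longrightarrow> ereal t < T \<Longrightarrow>
      ((\<lambda>s. X s $ i) has_vector_derivative velocity d \<epsilon> \<rho> \<xi> c (m (X t)) (P (X t)) (X t) i)
        (at t within {s. 0 \<le> s \<and> ereal s < T})"
    and initial: "\<And>i. X 0 $ i \<bullet> \<nu> \<le> \<mu>"
    and inside: "\<And>t i j. 0 \<le> t \<Longrightarrow> ereal t < T \<Longrightarrow>
      X t $ i \<in> frontier (cloud_hull (X t)) \<Longrightarrow> norm (X t $ j - X t $ i) < \<epsilon> \<Longrightarrow>
      points_inside (cloud_hull (X t)) (X t $ i)
        (proj_op c (P (X t) i) (P (X t) j) (X t $ j - X t $ i))"
  shows "\<forall>t. 0 \<le> t \<and> ereal t < T \<longrightarrow> (\<forall>i. X t $ i \<bullet> \<nu> \<le> \<mu>)"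
proof (intro allI impI)
  fix t i assume t: "0 \<le> t \<and> ereal t < T"
  \<comment> \<open>The maximum principle needs a compact interval, so the evolution on the
    half-open, possibly infinite time range is restricted to \<open>{0..t}\<close>.\<close>
  then have below: "ereal s < T" if "s \<le> t" for s
    using that by (metis ereal_less_eq(3) order_le_less_trans)
  define v where "v = (\<lambda>s i. velocity d \<epsilon> \<rho> \<xi> c (m (X s)) (P (X s)) (X s) i)"
  show "X t $ i \<bullet> \<nu> \<le> \<mu>"
  \<comment> \<open>Only a nonzero \<open>\<nu>\<close> defines a supporting hyperplane; for
    \<open>\<nu> = 0\<close> the claim is the initial condition
    \<open>0 \<le> \<mu>\<close>.\<close>
  proof (cases "\<nu> = 0")
    case True
    then show ?thesis using initial by simp
  next
    case False
    show ?thesis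
    proof (rule finite_family_le_initial_bound
        [where f = "\<lambda>i s. X s $ i \<bullet> \<nu>" and f' = "\<lambda>i s. v s i \<bullet> \<nu>" and a = 0])
      fix j s assume s: "s \<in> {0..t}"
      have "((\<lambda>s. X s $ j) has_vector_derivative v s j) (at s within {0..t})"
        unfolding v_def
        by (rule has_vector_derivative_within_subset[OF evolution]) (use s below in auto)
      then show "((\<lambda>s. X s $ j \<bullet> \<nu>) has_real_derivative v s j \<bullet> \<nu>) (at s within {0..t})"
        unfolding has_real_derivative_iff_has_vector_derivative
        by (rule bounded_linear.has_vector_derivative[OF bounded_linear_inner_left])
    next
      fix j s assume s: "s \<in> {0..t}" and active: "\<And>k. X s $ k \<bullet> \<nu> \<le> X s $ j \<bullet> \<nu>"
      have "0 \<le> s" "ereal s < T"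
        using s below by auto
      moreover have "X s $ j \<in> frontier (cloud_hull (X s))"
        using False active by (rule extreme_point_in_frontier_cloud_hull)
      ultimately show "v s j \<bullet> \<nu> \<le> 0"
        unfolding v_def
        by (intro velocity_inner_nonpos[OF kernels eps] masses denominators inside active)
    qed (use t initial in auto)
  qed
qed

end
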